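(* Let $\mathbf{E}$ be a Euclidean space, let $A,B$ be closed subsets of $\mathbf{E}$, let $\hat x\in S:=A\cap B$, and suppose the collection $\{A,B\}$ is locally linearly regular at $\hat x$ on $\mathbb{B}_\delta(\hat x)$ with constant $\kappa>0$ for some $\delta>0$. Suppose further that $B$ is a subspace and that $A$ is $(\varepsilon,\delta)$-subregular at $\hat x$ with respect to $S$. Assume that for some constant $c\in(0,1)$ the following holds: $\langle u,v\rangle\ge-c$ for all $z\in A\cap\mathbb{B}_\delta(\hat x)$, $u\in N_A(z)\cap\mathbb{B}$, $y\in B\cap\mathbb{B}_\delta(\hat x)$, $v\in N_B(y)\cap\mathbb{B}$. If $x\in\mathbb{B}_{\delta/2}(\hat x)$, then $$d(x_+,S)\le\sqrt{1+\tilde\varepsilon-\eta}\;d(x,S)\qquad\forall x_+\in T_{DR}x,$$ with $\eta:=\frac{1-c}{\kappa^2}$ and $\tilde\varepsilon:=2\varepsilon+2\varepsilon^2$.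
   Context: $\mathbf{E}$ is a (finite-dimensional) Euclidean space; $\mathbb{B}_\delta(\hat x)$ is the closed ball of radius $\delta$ about $\hat x$ and $\mathbb{B}$ the closed unit ball about $0$. For nonempty $\Omega\subset\mathbf{E}$, $d(x,\Omega)=\inf_{y\in\Omega}\|x-y\|$, the (multi-valued) projector is $P_\Omega x=\{y\in\Omega:\|x-y\|=d(x,\Omega)\}$, and the reflector is $R_\Omega x=2P_\Omega x-x=\{2p-x:p\in P_\Omega x\}$. Composition of multi-valued maps: $T_2T_1x=\bigcup_{y\in T_1x}T_2y$. The Douglas-Rachford operator is $T_{DR}x=\frac12(R_AR_Bx+x)=\{\frac12(w+x):w\in R_AR_Bx\}$. The proximal normal cone at $x\in\Omega$ is $N^P_\Omega(x)=\mathrm{cone}(P_\Omega^{-1}(x)-x)$, where $P_\Omega^{-1}(x)=\{w:x\in P_\Omega w\}$ and $\mathrm{cone}(K)$ is the smallest set containing $K$ closed under multiplication by positive scalars. The limiting normal cone $N_\Omega(x)$ consists of all $v$ for which there are $x_k\in\Omega$, $v_k\in N^P_\Omega(x_k)$ with $x_k\to x$ and $v_k\to v$. For $\varepsilon\ge0$, $\Omega$ is $(\varepsilon,\delta)$-subregular at $\hat x$ with respect to $S$ if $\langle v,\bar x-x\rangle\le\varepsilon\|v\|\|\bar x-x\|$ for all $x\in\mathbb{B}_\delta(\hat x)\cap\Omega$, $\bar x\in S\cap\mathbb{B}_\delta(\hat x)$, $v\in N^P_\Omega(x)$. $\{A,B\}$ is locally linearly regular at $\hat x\in A\cap B$ on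 $\mathbb{B}_\delta(\hat x)$ with constant $\kappa>0$ if $d(x,A\cap B)\le\kappa\max\{d(x,A),d(x,B)\}$ for all $x\in\mathbb{B}_\delta(\hat x)$. *)

theory Defs
  imports "HOL-Analysis.Analysis"
begin

definition projector :: "'a::euclidean_space set \<Rightarrow> 'a \<Rightarrow> 'a set"
  where "projector \<Omega> x = {y \<in> \<Omega>. norm (x - y) = infdist x \<Omega>}"

definition reflector :: "'a::euclidean_space set \<Rightarrow> 'a \<Rightarrow> 'a set"
  where "reflector \<Omega> x = {2 *\<^sub>R p - x | p. p \<in> projector \<Omega> x}"

definition mv_comp :: "('b \<Rightarrow> 'c set) \<Rightarrow> ('a \<Rightarrow> 'b set) \<Rightarrow> 'a \<Rightarrow> 'c set"
  where "mv_comp T\<^sub>2 T\<^sub>1 x = (\<Union>y\<in>T\<^sub>1 x. T\<^sub>2 y)"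

definition douglas_rachford :: "'a::euclidean_space set \<Rightarrow> 'a set \<Rightarrow> 'a \<Rightarrow> 'a set"
  where "douglas_rachford A B x =
    {(1/2) *\<^sub>R (w + x) | w. w \<in> mv_comp (reflector A) (reflector B) x}"

(* Only positive multiples are required here, unlike in the library's cone and conic,
   which also close under multiplication by 0. *)
definition pos_cone :: "'a::real_vector set \<Rightarrow> 'a set"
  where "pos_cone K = (\<lambda>C. \<forall>t>0. \<forall>v\<in>C. t *\<^sub>R v \<in> C) hull K"

definition proximal_normal_cone :: "'a::euclidean_space set \<Rightarrow> 'a \<Rightarrow> 'a set"
  where "proximal_normal_cone \<Omega> x = pos_cone {w - x | w. x \<in> projector \<Omega> w}"

definition limiting_normal_cone :: "'a::euclidean_space set \<Rightarrow> 'a \<Rightarrow> 'a set"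
  where "limiting_normal_cone \<Omega> x =
    {v. \<exists>xs vs. (\<forall>k::nat. xs k \<in> \<Omega> \<and> vs k \<in> proximal_normal_cone \<Omega> (xs k)) \<and>
                xs \<longlonglongrightarrow> x \<and> vs \<longlonglongrightarrow> v}"

definition subregular :: "real \<Rightarrow> real \<Rightarrow> 'a::euclidean_space set \<Rightarrow> 'a \<Rightarrow> 'a set \<Rightarrow> bool"
  where "subregular \<epsilon> \<delta> \<Omega> xhat S \<longleftrightarrow>
    (\<forall>x \<in> cball xhat \<delta> \<inter> \<Omega>. \<forall>xbar \<in> S \<inter> cball xhat \<delta>. \<forall>v \<in> proximal_normal_cone \<Omega> x.
      v \<bullet> (xbar - x) \<le> \<epsilon> * norm v * norm (xbar - x))"

definition locally_linearly_regular ::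
    "'a::euclidean_space set \<Rightarrow> 'a set \<Rightarrow> 'a \<Rightarrow> real \<Rightarrow> real \<Rightarrow> bool"
  where "locally_linearly_regular A B xhat \<delta> \<kappa> \<longleftrightarrow>
    (\<forall>x \<in> cball xhat \<delta>. infdist x (A \<inter> B) \<le> \<kappa> * max (infdist x A) (infdist x B))"

end

theory Submission
  imports Defs
begin

text \<open>
  Let \<open>y\<close> be the projection of \<open>x\<close> on \<open>B\<close>, let \<open>r = 2y - x\<close>, let \<open>z\<close> be a projection
  of \<open>r\<close> on \<open>A\<close>, and put \<open>v = x - y\<close>, \<open>u = r - z\<close>, so that the Douglas-Rachford point is
  \<open>y - u\<close>. For a point \<open>s\<close> of \<open>S\<close> nearest to \<open>x\<close>, subregularity and the angle condition
  give \<open>\<parallel>y - u - s\<parallel>\<^sup>2 \<le> \<parallel>x - s\<parallel>\<^sup>2 - (1 - c)(\<parallel>u\<parallel>\<^sup>2 + \<parallel>v\<parallel>\<^sup>2) + 2\<epsilon>\<parallel>u\<parallel>\<parallel>s - z\<parallel>\<close>.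
  Subregularity also yields \<open>\<parallel>s - z\<parallel> \<le> (1 + \<epsilon>)\<parallel>x - s\<parallel>\<close>. The regularity inequality is used
  at the reflected point \<open>r\<close> rather than at \<open>x\<close>: reflection in \<open>B\<close> preserves the distance to
  \<open>S\<close>, while \<open>d(r, A) = \<parallel>u\<parallel>\<close> and \<open>d(r, B) \<le> \<parallel>v\<parallel>\<close>.
\<close>

text \<open>The variational inequality at \<open>y\<close> can be tested with both
  \<open>y + b\<close> and \<open>y - b\<close>, since \<open>B\<close> is a subspace; the two
  opposite signs force equality.\<close>

lemma projector_subspace_orthogonal:
  assumes "closed B" "subspace B" "y \<in> projector B x" "b \<in> B"
  shows "(x - y) \<bullet> b = 0"
proof -
  have y: "y \<in> B" and d: "norm (x - y) = infdist x B"
    using assms(3) by (auto simp: projector_def)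
  have min: "\<forall>w\<in>B. dist x y \<le> dist x w"
    using d infdist_le[of _ B x] by (simp add: dist_norm)
  have le: "(x - y) \<bullet> b' \<le> 0" if "b' \<in> B" for b'
  proof -
    have "y + b' \<in> B"
      using subspace_add[OF assms(2) y that] .
    from any_closest_point_dot[OF subspace_imp_convex[OF assms(2)] assms(1) y this min]
    show ?thesis by simp
  qed
  from le[OF assms(4)] le[OF subspace_neg[OF assms(2,4)]] show ?thesis
    by (simp add: inner_minus_right)
qed

lemma projector_imp_proximal_normal:
  assumes "p \<in> projector \<Omega> w"
  shows "w - p \<in> proximal_normal_cone \<Omega> p"
  using assms unfolding proximal_normal_cone_def pos_cone_def
  by (intro hull_inc) blast

lemma pos_cone_scaleR:
  assumes "v \<in> pos_cone K" "t > 0"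
  shows "t *\<^sub>R v \<in> pos_cone K"
  using assms unfolding pos_cone_def hull_def by auto

lemma proximal_normal_cone_scaleR:
  assumes "v \<in> proximal_normal_cone \<Omega> x" "t > 0"
  shows "t *\<^sub>R v \<in> proximal_normal_cone \<Omega> x"
  using assms unfolding proximal_normal_cone_def by (rule pos_cone_scaleR)

lemma proximal_subset_limiting_normal_cone:
  assumes "x \<in> \<Omega>"
  shows "proximal_normal_cone \<Omega> x \<subseteq> limiting_normal_cone \<Omega> x"
proof
  fix v assume "v \<in> proximal_normal_cone \<Omega> x"
  then show "v \<in> limiting_normal_cone \<Omega> x"
    unfolding limiting_normal_cone_def mem_Collect_eq using assms
    by (intro exI[of _ "\<lambda>_. x"] exI[of _ "\<lambda>_. v"]) auto
qed

text \<open>The angle condition speaks of limiting normals in the unit ball, while projections yield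
  proximal normals of any length. Nonzero ones are normalized, which keeps them in the cone; if one
  vanishes, both sides are 0.\<close>

lemma inner_ge_of_unit_normals:
  assumes u: "u \<in> proximal_normal_cone A z" and z: "z \<in> A"
    and v: "v \<in> proximal_normal_cone B y" and y: "y \<in> B"
    and angle: "\<forall>u \<in> limiting_normal_cone A z \<inter> cball 0 1.
      \<forall>v \<in> limiting_normal_cone B y \<inter> cball 0 1. u \<bullet> v \<ge> - c"
  shows "u \<bullet> v \<ge> - c * (norm u * norm v)"
proof (cases "u = 0 \<or> v = 0")
  case False
  have "(1 / norm u) *\<^sub>R u \<in> limiting_normal_cone A z"
    using proximal_normal_cone_scaleR[OF u] proximal_subset_limiting_normal_cone[OF z] False
    by auto
  moreover have "(1 / norm v) *\<^sub>R v \<in> limiting_normal_cone B y"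
    using proximal_normal_cone_scaleR[OF v] proximal_subset_limiting_normal_cone[OF y] False
    by auto
  ultimately have "- c \<le> (1 / norm u) *\<^sub>R u \<bullet> (1 / norm v) *\<^sub>R v"
    by (intro angle[rule_format]) (use False in auto)
  also have "\<dots> = (u \<bullet> v) / (norm u * norm v)"
    by (simp add: divide_simps)
  finally show ?thesis
    using False by (simp add: pos_le_divide_eq)
qed auto

text \<open>Absorbs the cross term left by the angle condition into the two squares, by
  \<open>2ab \<le> a\<^sup>2 + b\<^sup>2\<close>.\<close>

lemma sum_squares_angle_bound:
  fixes a b c :: real
  assumes "c \<ge> 0"
  shows "- a\<^sup>2 - b\<^sup>2 + 2 * (c * (a * b)) \<le> - ((1 - c) * (a\<^sup>2 + b\<^sup>2))"
proof -
  have "2 * (a * b) \<le> a\<^sup>2 + b\<^sup>2"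
    using sum_squares_bound[of a b] by simp
  from mult_left_mono[OF this assms] show ?thesis
    by (simp add: algebra_simps)
qed

theorem theorem40:
  fixes A B :: "'a::euclidean_space set"
    and xhat x :: 'a
    and \<delta> \<kappa> \<epsilon> c :: real
  assumes "closed A" and "closed B"
    and "xhat \<in> A \<inter> B"
    and "\<delta> > 0" and "\<kappa> > 0"
    and "locally_linearly_regular A B xhat \<delta> \<kappa>"
    and "subspace B"
    and "\<epsilon> \<ge> 0"
    and "subregular \<epsilon> \<delta> A xhat (A \<inter> B)"
    and "0 < c" and "c < 1"
    and "\<forall>z \<in> A \<inter> cball xhat \<delta>. \<forall>u \<in> limiting_normal_cone A z \<inter> cball 0 1.
         \<forall>y \<in> B \<inter> cball xhat \<delta>. \<forall>v \<in> limiting_normal_cone B y \<inter> cball 0 1.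
           u \<bullet> v \<ge> - c"
    and "x \<in> cball xhat (\<delta> / 2)"
  shows "\<forall>xplus \<in> douglas_rachford A B x.
    infdist xplus (A \<inter> B)
      \<le> sqrt (1 + (2 * \<epsilon> + 2 * \<epsilon>\<^sup>2) - (1 - c) / \<kappa>\<^sup>2) * infdist x (A \<inter> B)"
proof
  let ?S = "A \<inter> B"
  define d where "d = infdist x ?S"
  fix xplus assume "xplus \<in> douglas_rachford A B x"
  then obtain y z where y: "y \<in> projector B x"
    and z: "z \<in> projector A (2 *\<^sub>R y - x)"
    and xplus: "xplus = (1/2) *\<^sub>R ((2 *\<^sub>R z - (2 *\<^sub>R y - x)) + x)"
    by (auto simp: douglas_rachford_def mv_comp_def reflector_def)
  define r where "r = 2 *\<^sub>R y - x"
  define u where "u = r - z"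
  define v where "v = x - y"
  have "(2 *\<^sub>R z - (2 *\<^sub>R y - x)) + x = 2 *\<^sub>R (y - u)"
    by (simp add: u_def r_def algebra_simps scaleR_2)
  then have xp: "xplus = y - u"
    by (simp add: xplus)
  have yB: "y \<in> B" using y by (simp add: projector_def)
  have zA: "z \<in> A" and zr: "norm (r - z) = infdist r A"
    using z by (auto simp: projector_def r_def)
  have orth: "v \<bullet> b = 0" if "b \<in> B" for b
    using projector_subspace_orthogonal[OF assms(2,7) y that] by (simp add: v_def)
  have x_eq: "x = y + v" and r_eq: "r = y - v" and z_eq: "z = y - v - u"
    by (simp_all add: v_def r_def u_def scaleR_2)
  \<comment> \<open>Since \<open>y - b\<close> lies in \<open>B\<close>, it is orthogonal to
    \<open>v\<close>, so \<open>(y - b) + v\<close> and \<open>(y - b) - v\<close> have the same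
    length.\<close>
  have pyth: "(norm (x - b))\<^sup>2 = (norm (y - b))\<^sup>2 + (norm v)\<^sup>2"
    and refl: "norm (r - b) = norm (x - b)" if "b \<in> B" for b
  proof -
    have *: "v \<bullet> (y - b) = 0"
      using orth subspace_diff[OF assms(7) yB that] by simp
    have eqs: "x - b = (y - b) + v" "r - b = (y - b) - v"
      by (simp_all add: x_eq r_eq)
    show "(norm (x - b))\<^sup>2 = (norm (y - b))\<^sup>2 + (norm v)\<^sup>2"
      using * unfolding eqs power2_norm_eq_inner
      by (simp add: inner_add_left inner_add_right inner_commute)
    have "(norm (r - b))\<^sup>2 = (norm (x - b))\<^sup>2"
      using * unfolding eqs power2_norm_eq_inner
      by (simp add: inner_add_left inner_add_right inner_diff_left inner_diff_right inner_commute)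
    then show "norm (r - b) = norm (x - b)" by simp
  qed
  have xh: "norm (x - xhat) \<le> \<delta> / 2"
    using assms(13) by (simp add: dist_norm norm_minus_commute)
  have ball: "w \<in> cball xhat \<delta>" if "norm (w - xhat) \<le> \<delta>" for w
    using that by (simp add: dist_norm norm_minus_commute)
  have clS: "closed ?S" and neS: "?S \<noteq> {}"
    using assms(1-3) by auto
  obtain s where s: "s \<in> ?S" and ds: "d = norm (x - s)"
    using infdist_attains_inf[OF clS neS, of x] by (auto simp: d_def dist_norm)
  \<comment> \<open>To apply the hypotheses, \<open>s\<close>, \<open>z\<close> and \<open>y\<close>
    must lie in the \<delta>-ball. As \<open>xhat\<close> competes in both minimizations,
    \<open>s\<close> and \<open>z\<close> are at most twice as far from \<open>xhat\<close> as
    \<open>x\<close> and \<open>r\<close> are; hence the radius \<delta>/2 for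
    \<open>x\<close>.\<close>
  have "d \<le> norm (x - xhat)"
    using infdist_le[OF assms(3), of x] by (simp add: d_def dist_norm)
  then have s_ball: "s \<in> cball xhat \<delta>"
    using xh norm_triangle_ineq4[of "x - xhat" "x - s"] ds by (intro ball) simp
  have rh: "norm (r - xhat) \<le> \<delta> / 2"
    using refl[of xhat] assms(3) xh by simp
  have u_le: "norm u \<le> norm (r - a)" if "a \<in> A" for a
    using infdist_le[OF that, of r] zr by (simp add: u_def dist_norm)
  have "norm u \<le> \<delta> / 2"
    using u_le[of xhat] assms(3) rh by simp
  then have z_ball: "z \<in> cball xhat \<delta>"
    using rh norm_triangle_ineq4[of "r - xhat" u] by (intro ball) (simp add: u_def)
  have y_ball: "y \<in> cball xhat \<delta>"
  proof (rule ball)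
    have "(norm (y - xhat))\<^sup>2 \<le> (norm (x - xhat))\<^sup>2"
      using pyth[of xhat] assms(3) by simp
    then show "norm (y - xhat) \<le> \<delta>"
      using xh assms(4) power2_le_imp_le[of "norm (y - xhat)" "norm (x - xhat)"] by simp
  qed
  have un: "u \<in> proximal_normal_cone A z"
    using projector_imp_proximal_normal[OF z] by (simp add: u_def r_def)
  have vn: "v \<in> proximal_normal_cone B y"
    using projector_imp_proximal_normal[OF y] by (simp add: v_def)
  have ang: "u \<bullet> v \<ge> - c * (norm u * norm v)"
    using assms(12) zA z_ball yB y_ball by (intro inner_ge_of_unit_normals[OF un zA vn yB]) blast
  have sub: "u \<bullet> (s - z) \<le> \<epsilon> * norm u * norm (s - z)"
    using assms(9) zA z_ball s s_ball un unfolding subregular_def by blast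
  have rs: "norm (r - s) = d"
    using refl[of s] s ds by simp
  have ud: "norm u \<le> d"
    using u_le[of s] s rs by simp
  have sz: "norm (s - z) \<le> (1 + \<epsilon>) * d"
  proof (cases "s = z")
    case False
    \<comment> \<open>Splitting \<open>s - z = (s - r) + u\<close> leaves Cauchy-Schwarz for the
      first summand and subregularity for the second; one factor \<open>norm (s - z)\<close> then
      cancels.\<close>
    have "(norm (s - z))\<^sup>2 = (s - r) \<bullet> (s - z) + u \<bullet> (s - z)"
      unfolding power2_norm_eq_inner u_def by (simp flip: inner_add_left)
    also have "\<dots> \<le> d * norm (s - z) + \<epsilon> * norm u * norm (s - z)"
      using norm_cauchy_schwarz[of "s - r" "s - z"] rs sub
      by (simp add: norm_minus_commute)
    also have "\<dots> \<le> d * norm (s - z) + \<epsilon> * d * norm (s - z)"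
      using ud assms(8) by (intro add_left_mono mult_right_mono mult_left_mono) auto
    finally have "norm (s - z) * norm (s - z) \<le> ((1 + \<epsilon>) * d) * norm (s - z)"
      by (simp add: power2_eq_square algebra_simps)
    then show ?thesis
      using False by simp
  qed (use assms(8) ds in simp)
  have err: "\<epsilon> * norm u * norm (s - z) \<le> (\<epsilon> + \<epsilon>\<^sup>2) * d\<^sup>2"
  proof -
    have "\<epsilon> * norm u * norm (s - z) \<le> \<epsilon> * d * ((1 + \<epsilon>) * d)"
      using ud sz assms(8) ds by (intro mult_mono mult_left_mono mult_nonneg_nonneg) auto
    then show ?thesis
      by (simp add: power2_eq_square algebra_simps)
  qed
  have reg: "d\<^sup>2 / \<kappa>\<^sup>2 \<le> (norm u)\<^sup>2 + (norm v)\<^sup>2"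
  proof -
    \<comment> \<open>The nearest point to \<open>r\<close> may differ from \<open>s\<close>, but
      \<open>s'\<close> is equally far from \<open>x\<close>, which bounds \<open>d\<close> from
      above.\<close>
    obtain s' where s': "s' \<in> ?S" "infdist r ?S = dist r s'"
      using infdist_attains_inf[OF clS neS, of r] by auto
    have "d \<le> infdist r ?S"
      using s' refl[of s'] infdist_le[OF s'(1), of x] by (simp add: d_def dist_norm)
    also have "\<dots> \<le> \<kappa> * max (infdist r A) (infdist r B)"
      using assms(4,6) rh ball[of r] unfolding locally_linearly_regular_def by auto
    also have "\<dots> \<le> \<kappa> * max (norm u) (norm v)"
      using infdist_le[OF yB, of r] zr assms(5)
      by (intro mult_left_mono max.mono) (auto simp: u_def r_eq dist_norm)
    finally have "d\<^sup>2 \<le> (\<kappa> * max (norm u) (norm v))\<^sup>2"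
      using ds by (intro power_mono) auto
    also have "\<dots> \<le> \<kappa>\<^sup>2 * ((norm u)\<^sup>2 + (norm v)\<^sup>2)"
      unfolding power_mult_distrib by (intro mult_left_mono) (auto simp: max_def)
    finally show ?thesis
      using assms(5) by (simp add: divide_le_eq mult.commute)
  qed
  have expand: "(norm (xplus - s))\<^sup>2
      = d\<^sup>2 - (norm v)\<^sup>2 - (norm u)\<^sup>2 - 2 * (u \<bullet> v) + 2 * (u \<bullet> (s - z))"
  proof -
    have "(norm (xplus - s))\<^sup>2 = (norm (y - s))\<^sup>2 - 2 * (u \<bullet> (y - s)) + (norm u)\<^sup>2"
      unfolding xp power2_norm_eq_inner
      by (simp add: inner_diff_left inner_diff_right inner_commute)
    \<comment> \<open>Rewriting \<open>z\<close> as \<open>y - v - u\<close> brings out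
      \<open>u \<bullet> v\<close> and lets the term in \<open>y - s\<close> be exchanged for the
      subregularity term.\<close>
    moreover have "u \<bullet> (s - z) = - (u \<bullet> (y - s)) + u \<bullet> v + (norm u)\<^sup>2"
      unfolding z_eq power2_norm_eq_inner
      by (simp add: inner_diff_right)
    ultimately show ?thesis
      using pyth[of s] s ds by simp
  qed
  have "(norm (xplus - s))\<^sup>2
      \<le> d\<^sup>2 - (1 - c) * ((norm u)\<^sup>2 + (norm v)\<^sup>2) + 2 * ((\<epsilon> + \<epsilon>\<^sup>2) * d\<^sup>2)"
    using expand ang sub err sum_squares_angle_bound[of c "norm u" "norm v"] assms(10)
    by linarith
  also have "\<dots> \<le> d\<^sup>2 - (1 - c) * (d\<^sup>2 / \<kappa>\<^sup>2) + 2 * ((\<epsilon> + \<epsilon>\<^sup>2) * d\<^sup>2)"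
    using mult_left_mono[OF reg, of "1 - c"] assms(11) by simp
  also have "\<dots> = (1 + (2 * \<epsilon> + 2 * \<epsilon>\<^sup>2) - (1 - c) / \<kappa>\<^sup>2) * d\<^sup>2"
    by (simp add: algebra_simps diff_divide_distrib)
  finally have "norm (xplus - s) \<le> sqrt ((1 + (2 * \<epsilon> + 2 * \<epsilon>\<^sup>2) - (1 - c) / \<kappa>\<^sup>2) * d\<^sup>2)"
    by (rule real_le_rsqrt)
  \<comment> \<open>The real \<open>sqrt\<close> is odd, hence multiplicative on all reals, so this
    also covers a negative radicand, which can occur when \<open>d = 0\<close>.\<close>
  also have "\<dots> = sqrt (1 + (2 * \<epsilon> + 2 * \<epsilon>\<^sup>2) - (1 - c) / \<kappa>\<^sup>2) * d"
    using ds by (simp add: real_sqrt_mult)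
  finally show "infdist xplus ?S
      \<le> sqrt (1 + (2 * \<epsilon> + 2 * \<epsilon>\<^sup>2) - (1 - c) / \<kappa>\<^sup>2) * infdist x ?S"
    using infdist_le[OF s, of xplus] by (simp add: d_def dist_norm)
qed

end
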